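(* Let $\mathcal R=(G,\Lambda,N)$ be a faithful, complete, abridged protorootoid. Let $a\in\mathrm{ob}(G)$. (a) The weak right order ${}_a{\le}$ on ${}_aG$ has a maximum element $\omega(a)$. It satisfies $\omega(a)=\bigvee{}_aG$ in ${}_aG$ and $N(\omega(a))=\bigvee{}_a\mathcal L$ in ${}_a\mathcal L$. (b) $e_a:=N(\omega(a))$ is an identity element of (the Boolean algebra) $\Lambda(a)$. (c) $\mathcal R$ is a unitary protorootoid. (d) Let $a':=\mathrm{dom}(\omega(a))\in\mathrm{ob}(G)$, so that $\omega(a)\in{}_aG_{a'}$. Then $\omega(a)^{*}=\omega(a')$. (e) The map $h\mapsto\omega(a)h\colon{}_{a'}G\to{}_aG$ is an order anti-isomorphism in the weak right orders. (f) For $g\in{}_bG_a$, $N(g\omega(a))=N(g)^{\complement}:=e_b+N(g)$ in $\Lambda(b)$. (g) ${}_a\mathcal L$ is a complete ortholattice with orthocomplement given by restriction of the complement $A\mapsto A^{\complement}$ in the Boolean algebra $\Lambda(a)$. (h) $\mathcal R$ is a complemented, complete rootoid.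
   Context: A groupoid is a small category in which every morphism is invertible. For a groupoid $G$, ${}_aG_b=\mathrm{Hom}_G(b,a)$, ${}_aG$ is the set of morphisms with codomain $a$, $\mathrm{dom}(g)$ is the domain of $g$, and $g^*=g^{-1}$. A Boolean ring is a (possibly non-unital) ring in which every element is idempotent, partially ordered by $x\subseteq y\iff xy=x$; write $x\cap y=xy$, $\emptyset=0$. A unital Boolean ring is called a Boolean algebra, with complement $x^{\complement}=1+x$. A protorootoid is a triple $\mathcal R=(G,\Lambda,N)$ with $G$ a groupoid, $\Lambda$ a functor from $G$ to the category of Boolean rings and (not necessarily unital) ring homomorphisms, and $N$ assigning to each $g\in{}_aG$ an element $N(g)\in\Lambda(a)$ such that $N(gh)=N(g)+\Lambda(g)(N(h))$ whenever $gh$ is defined. The weak order at $a$ is the subposet ${}_a\mathcal L=\{N(g)\mid g\in{}_aG\}$ of $\Lambda(a)$. The weak right preorder ${}_a{\le}$ on ${}_aG$ is $x\;{}_a{\le}\;y\iff N(x)\subseteq N(y)$. $\mathcal R$ is: faithful if $g\in{}_aG$ and $N(g)=\emptyset$ imply $g=1_a$ (then the weak right preorders are partial orders, called weak right orders); complete if each ${}_a\mathcal L$ is a complete lattice; abridged if each $\Lambda(a)$ is generated as a ring by ${}_a\mathcal L$; unitary if each $\Lambda(a)$ is a Boolean algebra and each $\Lambda(g)$ preserves identity elements; complemented if it is unitary and $A\in{}_a\mathcal L$ implies $A^{\complement}\in{}_a\mathcal L$ for all $a$. $\mathcal R$ is a rootoid if: (i) for $g,h\in{}_aG$, $N(g)=N(h)$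 implies $g=h$; (ii) each ${}_a\mathcal L$ is a complete meet semilattice (every non-empty subset has a meet); (iii) if $A_i,B\in{}_a\mathcal L$ with $A_i\cap B=\emptyset$ for all $i$ and $A=\bigvee_iA_i$ exists in ${}_a\mathcal L$, then $A\cap B=\emptyset$. A complete ortholattice is a complete lattice with an order-reversing map $x\mapsto x^{\complement}$ with $(x^{\complement})^{\complement}=x$, $x\wedge x^{\complement}=0$ (minimum) and $x\vee x^{\complement}=1$ (maximum) for all $x$. *)

theory Defs
  imports "HOL-Algebra.Ring" "HOL-Algebra.Complete_Lattice"
begin

section \<open>Groupoids\<close>

record ('o, 'm) small_cat =
  Obj :: "'o set"
  Arr :: "'m set"
  Dom :: "'m \<Rightarrow> 'o"
  Cod :: "'m \<Rightarrow> 'o"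
  Ide :: "'o \<Rightarrow> 'm"
  Comp :: "'m \<Rightarrow> 'm \<Rightarrow> 'm" (infixl "\<cdot>\<index>" 70)

text \<open>Composition is written in functional order: \<open>g \<cdot> h\<close> is defined when \<open>Dom g = Cod h\<close>.
  Outside this range the value of \<open>Comp\<close> is unspecified.\<close>

locale small_category =
  fixes G (structure)
  assumes Dom_Obj: "g \<in> Arr G \<Longrightarrow> Dom G g \<in> Obj G"
    and Cod_Obj: "g \<in> Arr G \<Longrightarrow> Cod G g \<in> Obj G"
    and Ide_Arr: "a \<in> Obj G \<Longrightarrow> Ide G a \<in> Arr G"
    and Dom_Ide: "a \<in> Obj G \<Longrightarrow> Dom G (Ide G a) = a"
    and Cod_Ide: "a \<in> Obj G \<Longrightarrow> Cod G (Ide G a) = a"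
    and Comp_Arr: "\<lbrakk>g \<in> Arr G; h \<in> Arr G; Dom G g = Cod G h\<rbrakk> \<Longrightarrow> g \<cdot> h \<in> Arr G"
    and Dom_Comp: "\<lbrakk>g \<in> Arr G; h \<in> Arr G; Dom G g = Cod G h\<rbrakk> \<Longrightarrow> Dom G (g \<cdot> h) = Dom G h"
    and Cod_Comp: "\<lbrakk>g \<in> Arr G; h \<in> Arr G; Dom G g = Cod G h\<rbrakk> \<Longrightarrow> Cod G (g \<cdot> h) = Cod G g"
    and Comp_Ide: "g \<in> Arr G \<Longrightarrow> g \<cdot> Ide G (Dom G g) = g"
    and Ide_Comp: "g \<in> Arr G \<Longrightarrow> Ide G (Cod G g) \<cdot> g = g"
    and Comp_assoc: "\<lbrakk>g \<in> Arr G; h \<in> Arr G; k \<in> Arr G; Dom G g = Cod G h; Dom G h = Cod G k\<rbrakk>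
      \<Longrightarrow> (g \<cdot> h) \<cdot> k = g \<cdot> (h \<cdot> k)"

definition inverse_arrow :: "('o, 'm, 'c) small_cat_scheme \<Rightarrow> 'm \<Rightarrow> 'm \<Rightarrow> bool" where
  "inverse_arrow G g h \<longleftrightarrow> h \<in> Arr G \<and> Dom G h = Cod G g \<and> Cod G h = Dom G g \<and>
     g \<cdot>\<^bsub>G\<^esub> h = Ide G (Cod G g) \<and> h \<cdot>\<^bsub>G\<^esub> g = Ide G (Dom G g)"

locale groupoid = small_category +
  assumes invertible: "g \<in> Arr G \<Longrightarrow> \<exists>h. inverse_arrow G g h"

definition star :: "('o, 'm, 'c) small_cat_scheme \<Rightarrow> 'm \<Rightarrow> 'm" where
  "star G g = (THE h. inverse_arrow G g h)"

text \<open>\<open>into G a\<close> is \<open>\<^sub>aG\<close>, and \<open>hom_set G a b\<close> is \<open>\<^sub>aG\<^sub>b\<close>, the arrows from \<open>b\<close> to \<open>a\<close>.\<close>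

definition into :: "('o, 'm, 'c) small_cat_scheme \<Rightarrow> 'o \<Rightarrow> 'm set" where
  "into G a = {g \<in> Arr G. Cod G g = a}"

definition hom_set :: "('o, 'm, 'c) small_cat_scheme \<Rightarrow> 'o \<Rightarrow> 'o \<Rightarrow> 'm set" where
  "hom_set G a b = {g \<in> Arr G. Cod G g = a \<and> Dom G g = b}"


section \<open>Boolean rings\<close>

text \<open>Boolean rings need not be unital. They are carried by the record type of HOL-Algebra rings,
  but its field \<open>one\<close> plays no role in anything below: an identity element, when there is one,
  is given by \<open>identity\<close>.\<close>

locale boolean_rng = abelian_group R for R (structure) +
  assumes mult_closed: "\<lbrakk>x \<in> carrier R; y \<in> carrier R\<rbrakk> \<Longrightarrow> x \<otimes> y \<in> carrier R"
    and mult_assoc: "\<lbrakk>x \<in> carrier R; y \<in> carrier R; z \<in> carrier R\<rbrakk>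
      \<Longrightarrow> (x \<otimes> y) \<otimes> z = x \<otimes> (y \<otimes> z)"
    and distrib_right: "\<lbrakk>x \<in> carrier R; y \<in> carrier R; z \<in> carrier R\<rbrakk>
      \<Longrightarrow> (x \<oplus> y) \<otimes> z = x \<otimes> z \<oplus> y \<otimes> z"
    and distrib_left: "\<lbrakk>x \<in> carrier R; y \<in> carrier R; z \<in> carrier R\<rbrakk>
      \<Longrightarrow> z \<otimes> (x \<oplus> y) = z \<otimes> x \<oplus> z \<otimes> y"
    and idem: "x \<in> carrier R \<Longrightarrow> x \<otimes> x = x"

definition rng_hom :: "('b, 'c) ring_scheme \<Rightarrow> ('b, 'd) ring_scheme \<Rightarrow> ('b \<Rightarrow> 'b) \<Rightarrow> bool" where
  "rng_hom R S f \<longleftrightarrow> f \<in> carrier R \<rightarrow> carrier S \<and>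
     (\<forall>x\<in>carrier R. \<forall>y\<in>carrier R. f (x \<oplus>\<^bsub>R\<^esub> y) = f x \<oplus>\<^bsub>S\<^esub> f y \<and> f (x \<otimes>\<^bsub>R\<^esub> y) = f x \<otimes>\<^bsub>S\<^esub> f y)"

definition is_identity :: "('b, 'c) ring_scheme \<Rightarrow> 'b \<Rightarrow> bool" where
  "is_identity R e \<longleftrightarrow> e \<in> carrier R \<and> (\<forall>x\<in>carrier R. e \<otimes>\<^bsub>R\<^esub> x = x \<and> x \<otimes>\<^bsub>R\<^esub> e = x)"

definition identity :: "('b, 'c) ring_scheme \<Rightarrow> 'b" where
  "identity R = (THE e. is_identity R e)"

definition boolean_alg :: "('b, 'c) ring_scheme \<Rightarrow> bool" where
  "boolean_alg R \<longleftrightarrow> boolean_rng R \<and> (\<exists>e. is_identity R e)"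

definition compl :: "('b, 'c) ring_scheme \<Rightarrow> 'b \<Rightarrow> 'b" where
  "compl R x = identity R \<oplus>\<^bsub>R\<^esub> x"

definition sub :: "('b, 'c) ring_scheme \<Rightarrow> 'b \<Rightarrow> 'b \<Rightarrow> bool" where
  "sub R x y \<longleftrightarrow> x \<otimes>\<^bsub>R\<^esub> y = x"

inductive_set rng_span :: "('b, 'c) ring_scheme \<Rightarrow> 'b set \<Rightarrow> 'b set"
  for R :: "('b, 'c) ring_scheme" and S :: "'b set" where
  zero: "\<zero>\<^bsub>R\<^esub> \<in> rng_span R S"
| incl: "x \<in> S \<Longrightarrow> x \<in> rng_span R S"
| neg: "x \<in> rng_span R S \<Longrightarrow> \<ominus>\<^bsub>R\<^esub> x \<in> rng_span R S"
| add: "\<lbrakk>x \<in> rng_span R S; y \<in> rng_span R S\<rbrakk> \<Longrightarrow> x \<oplus>\<^bsub>R\<^esub> y \<in> rng_span R S"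
| mult: "\<lbrakk>x \<in> rng_span R S; y \<in> rng_span R S\<rbrakk> \<Longrightarrow> x \<otimes>\<^bsub>R\<^esub> y \<in> rng_span R S"


section \<open>Orders\<close>

definition order_anti_iso ::
    "('x, 'c) gorder_scheme \<Rightarrow> ('y, 'd) gorder_scheme \<Rightarrow> ('x \<Rightarrow> 'y) \<Rightarrow> bool" where
  "order_anti_iso A B f \<longleftrightarrow> bij_betw f (carrier A) (carrier B) \<and>
     (\<forall>x\<in>carrier A. \<forall>y\<in>carrier A. x \<sqsubseteq>\<^bsub>A\<^esub> y \<longleftrightarrow> f y \<sqsubseteq>\<^bsub>B\<^esub> f x)"

definition complete_meet_semilattice :: "('x, 'c) gorder_scheme \<Rightarrow> bool" where
  "complete_meet_semilattice L \<longleftrightarrow> partial_order L \<and>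
     (\<forall>X. X \<subseteq> carrier L \<and> X \<noteq> {} \<longrightarrow> (\<exists>m. greatest L m (Lower L X)))"

definition complete_ortholattice :: "('x, 'c) gorder_scheme \<Rightarrow> ('x \<Rightarrow> 'x) \<Rightarrow> bool" where
  "complete_ortholattice L c \<longleftrightarrow> complete_lattice L \<and> c \<in> carrier L \<rightarrow> carrier L \<and>
     (\<forall>x\<in>carrier L. \<forall>y\<in>carrier L. x \<sqsubseteq>\<^bsub>L\<^esub> y \<longrightarrow> c y \<sqsubseteq>\<^bsub>L\<^esub> c x) \<and>
     (\<forall>x\<in>carrier L. c (c x) = x \<and> x \<sqinter>\<^bsub>L\<^esub> c x = \<bottom>\<^bsub>L\<^esub> \<and> x \<squnion>\<^bsub>L\<^esub> c x = \<top>\<^bsub>L\<^esub>)"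


section \<open>Protorootoids\<close>

text \<open>A triple \<open>(G, \<Lambda>, N)\<close>; the functor \<open>\<Lambda>\<close> is split into its object part \<open>Lam\<close> and its arrow part
  \<open>Act\<close>, where \<open>Act R g\<close> is relevant only on the carrier of \<open>Lam R (Dom g)\<close>.\<close>

record ('o, 'm, 'b) protorootoid_data =
  Gpd :: "('o, 'm) small_cat"
  Lam :: "'o \<Rightarrow> 'b ring"
  Act :: "'m \<Rightarrow> 'b \<Rightarrow> 'b"
  Ncoc :: "'m \<Rightarrow> 'b"

locale protorootoid =
  fixes R :: "('o, 'm, 'b, 'c) protorootoid_data_scheme"
  assumes groupoid: "groupoid (Gpd R)"
    and Lam_boolean: "a \<in> Obj (Gpd R) \<Longrightarrow> boolean_rng (Lam R a)"
    and Act_hom: "g \<in> Arr (Gpd R) \<Longrightarrow>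
      rng_hom (Lam R (Dom (Gpd R) g)) (Lam R (Cod (Gpd R) g)) (Act R g)"
    and Act_Ide: "\<lbrakk>a \<in> Obj (Gpd R); x \<in> carrier (Lam R a)\<rbrakk> \<Longrightarrow> Act R (Ide (Gpd R) a) x = x"
    and Act_Comp: "\<lbrakk>g \<in> Arr (Gpd R); h \<in> Arr (Gpd R); Dom (Gpd R) g = Cod (Gpd R) h;
        x \<in> carrier (Lam R (Dom (Gpd R) h))\<rbrakk> \<Longrightarrow> Act R (g \<cdot>\<^bsub>Gpd R\<^esub> h) x = Act R g (Act R h x)"
    and Ncoc_in: "g \<in> Arr (Gpd R) \<Longrightarrow> Ncoc R g \<in> carrier (Lam R (Cod (Gpd R) g))"
    and Ncoc_Comp: "\<lbrakk>g \<in> Arr (Gpd R); h \<in> Arr (Gpd R); Dom (Gpd R) g = Cod (Gpd R) h\<rbrakk> \<Longrightarrow>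
      Ncoc R (g \<cdot>\<^bsub>Gpd R\<^esub> h) = Ncoc R g \<oplus>\<^bsub>Lam R (Cod (Gpd R) g)\<^esub> Act R g (Ncoc R h)"

definition weak_order :: "('o, 'm, 'b, 'c) protorootoid_data_scheme \<Rightarrow> 'o \<Rightarrow> 'b gorder" where
  "weak_order R a = \<lparr>carrier = Ncoc R ` into (Gpd R) a, eq = (=), le = sub (Lam R a)\<rparr>"

definition weak_right_order :: "('o, 'm, 'b, 'c) protorootoid_data_scheme \<Rightarrow> 'o \<Rightarrow> 'm gorder" where
  "weak_right_order R a =
     \<lparr>carrier = into (Gpd R) a, eq = (=), le = (\<lambda>x y. sub (Lam R a) (Ncoc R x) (Ncoc R y))\<rparr>"

definition faithful :: "('o, 'm, 'b, 'c) protorootoid_data_scheme \<Rightarrow> bool" where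
  "faithful R \<longleftrightarrow> (\<forall>a\<in>Obj (Gpd R). \<forall>g\<in>into (Gpd R) a.
     Ncoc R g = \<zero>\<^bsub>Lam R a\<^esub> \<longrightarrow> g = Ide (Gpd R) a)"

definition complete :: "('o, 'm, 'b, 'c) protorootoid_data_scheme \<Rightarrow> bool" where
  "complete R \<longleftrightarrow> (\<forall>a\<in>Obj (Gpd R). complete_lattice (weak_order R a))"

definition abridged :: "('o, 'm, 'b, 'c) protorootoid_data_scheme \<Rightarrow> bool" where
  "abridged R \<longleftrightarrow> (\<forall>a\<in>Obj (Gpd R).
     rng_span (Lam R a) (carrier (weak_order R a)) = carrier (Lam R a))"

definition unitary :: "('o, 'm, 'b, 'c) protorootoid_data_scheme \<Rightarrow> bool" where
  "unitary R \<longleftrightarrow> (\<forall>a\<in>Obj (Gpd R). boolean_alg (Lam R a)) \<and>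
     (\<forall>g\<in>Arr (Gpd R). Act R g (identity (Lam R (Dom (Gpd R) g))) = identity (Lam R (Cod (Gpd R) g)))"

definition complemented :: "('o, 'm, 'b, 'c) protorootoid_data_scheme \<Rightarrow> bool" where
  "complemented R \<longleftrightarrow> unitary R \<and> (\<forall>a\<in>Obj (Gpd R). \<forall>A\<in>carrier (weak_order R a).
     compl (Lam R a) A \<in> carrier (weak_order R a))"

locale rootoid = protorootoid +
  assumes Ncoc_inj: "\<lbrakk>a \<in> Obj (Gpd R); g \<in> into (Gpd R) a; h \<in> into (Gpd R) a;
      Ncoc R g = Ncoc R h\<rbrakk> \<Longrightarrow> g = h"
    and meets: "a \<in> Obj (Gpd R) \<Longrightarrow> complete_meet_semilattice (weak_order R a)"
    and join_orthogonality: "\<lbrakk>a \<in> Obj (Gpd R); X \<subseteq> carrier (weak_order R a);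
      B \<in> carrier (weak_order R a); \<forall>A\<in>X. A \<otimes>\<^bsub>Lam R a\<^esub> B = \<zero>\<^bsub>Lam R a\<^esub>;
      least (weak_order R a) J (Upper (weak_order R a) X)\<rbrakk> \<Longrightarrow> J \<otimes>\<^bsub>Lam R a\<^esub> B = \<zero>\<^bsub>Lam R a\<^esub>"

definition is_maximum :: "('x, 'c) gorder_scheme \<Rightarrow> 'x \<Rightarrow> bool" where
  "is_maximum L w \<longleftrightarrow> greatest L w (carrier L)"

definition omega :: "('o, 'm, 'b, 'c) protorootoid_data_scheme \<Rightarrow> 'o \<Rightarrow> 'm" where
  "omega R a = (THE w. is_maximum (weak_right_order R a) w)"

end

theory Submission
  imports Defs
begin

text \<open>The top of the weak order at \<open>a\<close> is \<open>N \<omega>\<close> for a unique arrow \<open>\<omega>\<close>. It absorbs every generator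
  of \<open>\<Lambda> a\<close>, so it is an identity element, and the bijective homomorphisms \<open>\<Lambda> g\<close> preserve it.
  The cocycle identity then gives \<open>N (g \<omega>) = N g + 1\<close>: right multiplication by \<open>\<omega>\<close> is
  complementation. Everything else follows from this, because weak orders are closed under
  complements.\<close>

section \<open>Boolean rings\<close>

lemma is_identity_unique:
  assumes "is_identity R e" "is_identity R f"
  shows "e = f"
  using assms unfolding is_identity_def by metis

lemma identity_eqI: "is_identity R e \<Longrightarrow> identity R = e"
  unfolding identity_def by (blast intro: the_equality is_identity_unique)

context boolean_rng
begin

lemma zero_mult: "x \<in> carrier R \<Longrightarrow> \<zero> \<otimes> x = \<zero>"
  by (metis add.l_cancel_one' distrib_right l_zero mult_closed zero_closed)

text \<open>Idempotence of \<open>x \<oplus> x\<close> together with distributivity produces four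
  copies of \<open>x\<close> equal to two, and cancellation in the additive group leaves
  characteristic two.\<close>

lemma add_self:
  assumes x: "x \<in> carrier R"
  shows "x \<oplus> x = \<zero>"
proof -
  have "(x \<oplus> x) \<oplus> (x \<oplus> x) = (x \<oplus> x) \<otimes> (x \<oplus> x)"
    using x by (simp add: distrib_left distrib_right idem[OF x])
  also have "\<dots> = x \<oplus> x"
    using x by (simp add: idem)
  finally show ?thesis
    using x by simp
qed

lemma minus_self: "x \<in> carrier R \<Longrightarrow> \<ominus> x = x"
  using add_self minus_equality by blast

lemma add_add_self: "\<lbrakk>x \<in> carrier R; y \<in> carrier R\<rbrakk> \<Longrightarrow> x \<oplus> (x \<oplus> y) = y"
  using r_neg1 minus_self by metis

lemma add_eq_zeroD: "\<lbrakk>x \<in> carrier R; y \<in> carrier R; x \<oplus> y = \<zero>\<rbrakk> \<Longrightarrow> x = y"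
  by (metis add_add_self r_zero)

text \<open>The square of \<open>x \<oplus> y\<close> is itself, so the cross terms
  \<open>x \<otimes> y\<close> and \<open>y \<otimes> x\<close> sum to zero. In characteristic two
  they therefore coincide.\<close>

lemma mult_comm:
  assumes x: "x \<in> carrier R" and y: "y \<in> carrier R"
  shows "x \<otimes> y = y \<otimes> x"
proof -
  have xy: "x \<otimes> y \<in> carrier R" and yx: "y \<otimes> x \<in> carrier R"
    using x y by (auto intro: mult_closed)
  have "x \<oplus> (y \<oplus> (x \<otimes> y \<oplus> y \<otimes> x)) = (x \<oplus> y) \<otimes> (x \<oplus> y)"
    using x y xy yx by (simp add: distrib_left distrib_right idem[OF x] idem[OF y] a_ac)
  also have "\<dots> = x \<oplus> (y \<oplus> \<zero>)"
    using x y by (simp add: idem[OF a_closed])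
  finally have "x \<otimes> y \<oplus> y \<otimes> x = \<zero>"
    using x y xy yx by (metis a_closed add_add_self zero_closed)
  then show ?thesis
    using xy yx add_eq_zeroD by blast
qed

lemma sub_antisym: "\<lbrakk>x \<in> carrier R; y \<in> carrier R; sub R x y; sub R y x\<rbrakk> \<Longrightarrow> x = y"
  by (metis sub_def mult_comm)

lemma zero_sub: "x \<in> carrier R \<Longrightarrow> sub R \<zero> x"
  by (simp add: sub_def zero_mult)

section \<open>Complements in a Boolean ring with an identity element\<close>

context
  fixes e
  assumes e: "is_identity R e"
begin

lemma identity_closed: "e \<in> carrier R"
  using e by (simp add: is_identity_def)

lemma identity_mult: "x \<in> carrier R \<Longrightarrow> e \<otimes> x = x"
  and mult_identity: "x \<in> carrier R \<Longrightarrow> x \<otimes> e = x"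
  using e by (simp_all add: is_identity_def)

lemma compl_eq: "compl R x = e \<oplus> x"
  by (simp add: compl_def identity_eqI[OF e])

lemma compl_closed: "x \<in> carrier R \<Longrightarrow> compl R x \<in> carrier R"
  by (simp add: compl_eq identity_closed)

lemma compl_compl: "x \<in> carrier R \<Longrightarrow> compl R (compl R x) = x"
  by (simp add: compl_eq identity_closed add_add_self)

text \<open>Since \<open>x(1 + y) = x + xy\<close>, this product is \<open>x\<close> exactly when
  \<open>xy\<close> vanishes. Disjointness thereby becomes an order relation, which is what joins
  can be tested against.\<close>

lemma sub_compl_iff:
  assumes "x \<in> carrier R" "y \<in> carrier R"
  shows "sub R x (compl R y) \<longleftrightarrow> x \<otimes> y = \<zero>"
proof -
  have "x \<otimes> compl R y = x \<oplus> x \<otimes> y"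
    using assms by (simp add: compl_eq distrib_left identity_closed mult_identity)
  then show ?thesis
    using assms by (simp add: sub_def mult_closed)
qed

text \<open>By the disjointness criterion the left side says \<open>(1 + x)y = y + xy = 0\<close>,
  and in characteristic two this means \<open>y = xy\<close>.\<close>

lemma compl_sub_compl_iff:
  assumes "x \<in> carrier R" "y \<in> carrier R"
  shows "sub R (compl R x) (compl R y) \<longleftrightarrow> sub R y x"
proof -
  have "sub R (compl R x) (compl R y) \<longleftrightarrow> y \<oplus> x \<otimes> y = \<zero>"
    using assms by (simp add: sub_compl_iff compl_closed)
      (simp add: compl_eq distrib_right identity_closed identity_mult)
  also have "\<dots> \<longleftrightarrow> sub R y x"
    using assms by (metis sub_def add_self add_eq_zeroD mult_closed mult_comm)
  finally show ?thesis .
qed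

lemma sub_self_compl:
  assumes "x \<in> carrier R" "z \<in> carrier R" "sub R z x" "sub R z (compl R x)"
  shows "z = \<zero>"
  using assms by (simp add: sub_compl_iff) (simp add: sub_def)

end

text \<open>The elements fixed by multiplication with \<open>e\<close> form a subring. It contains
  \<open>S\<close>, hence everything that \<open>S\<close> generates; commutativity handles the
  other side.\<close>

lemma is_identityI_span:
  assumes S: "S \<subseteq> carrier R" "rng_span R S = carrier R"
    and e: "e \<in> carrier R" "\<And>x. x \<in> S \<Longrightarrow> sub R x e"
  shows "is_identity R e"
proof -
  \<comment> \<open>Carrier membership is carried through the induction because the ring laws hold
    only on the carrier.\<close>
  have "x \<in> carrier R \<and> x \<otimes> e = x" if "x \<in> rng_span R S" for x
    using that
  proof induction
    case (neg x)
    then show ?case by (simp add: minus_self)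
  qed (use S e in \<open>auto simp: zero_mult sub_def distrib_right mult_assoc intro: mult_closed\<close>)
  then show ?thesis
    using S e by (simp add: is_identity_def mult_comm)
qed

end

text \<open>A homomorphism here need not respect identities, but a surjective one must: every
  element of \<open>S\<close> is some \<open>f x\<close>, and \<open>f e\<close> acts on it as
  \<open>e\<close> acts on \<open>x\<close>.\<close>

lemma is_identity_image:
  assumes f: "rng_hom R S f" "f ` carrier R = carrier S" and e: "is_identity R e"
  shows "is_identity S (f e)"
  unfolding is_identity_def
proof (intro conjI ballI)
  show "f e \<in> carrier S"
    using f e by (auto simp: rng_hom_def is_identity_def)
next
  fix y assume "y \<in> carrier S"
  then obtain x where "x \<in> carrier R" "y = f x"
    using f by blast
  then show "f e \<otimes>\<^bsub>S\<^esub> y = y" "y \<otimes>\<^bsub>S\<^esub> f e = y"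
    using f e unfolding rng_hom_def is_identity_def by metis+
qed

section \<open>Groupoids\<close>

context groupoid
begin

text \<open>Only a right inverse is asked of \<open>k\<close>, so that one equation suffices to
  recognise \<open>star G g\<close>; associativity gives
  \<open>k = (h g) k = h (g k) = h\<close>.\<close>

lemma inverse_arrow_unique:
  assumes g: "g \<in> Arr G" and h: "inverse_arrow G g h"
    and k: "k \<in> Arr G" "Cod G k = Dom G g" "g \<cdot> k = Ide G (Cod G g)"
  shows "k = h"
proof -
  have "k = (h \<cdot> g) \<cdot> k"
    using h k Ide_Comp by (metis inverse_arrow_def)
  also have "\<dots> = h \<cdot> (g \<cdot> k)"
    using g h k by (intro Comp_assoc) (simp_all add: inverse_arrow_def)
  also have "\<dots> = h"
    using h k Comp_Ide by (metis inverse_arrow_def)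
  finally show ?thesis .
qed

lemma inverse_arrow_star:
  assumes "g \<in> Arr G"
  shows "inverse_arrow G g (star G g)"
proof -
  have "\<exists>!h. inverse_arrow G g h"
    using assms invertible inverse_arrow_unique by (metis inverse_arrow_def)
  then show ?thesis
    unfolding star_def by (rule theI')
qed

lemma star_Arr: "g \<in> Arr G \<Longrightarrow> star G g \<in> Arr G"
  and Dom_star: "g \<in> Arr G \<Longrightarrow> Dom G (star G g) = Cod G g"
  and Cod_star: "g \<in> Arr G \<Longrightarrow> Cod G (star G g) = Dom G g"
  and Comp_star: "g \<in> Arr G \<Longrightarrow> g \<cdot> star G g = Ide G (Cod G g)"
  and star_Comp: "g \<in> Arr G \<Longrightarrow> star G g \<cdot> g = Ide G (Dom G g)"
  using inverse_arrow_star by (simp_all add: inverse_arrow_def)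

lemma star_eqI:
  assumes "g \<in> Arr G" "k \<in> Arr G" "Cod G k = Dom G g" "g \<cdot> k = Ide G (Cod G g)"
  shows "star G g = k"
  using assms inverse_arrow_unique inverse_arrow_star by metis

lemma star_Comp_cancel:
  assumes "g \<in> Arr G" "h \<in> Arr G" "Cod G h = Dom G g"
  shows "star G g \<cdot> (g \<cdot> h) = h"
  using assms by (metis Comp_assoc Dom_star Ide_Comp star_Arr star_Comp)

lemma Comp_star_cancel:
  assumes "g \<in> Arr G" "h \<in> Arr G" "Cod G h = Cod G g"
  shows "g \<cdot> (star G g \<cdot> h) = h"
  using assms by (metis Comp_assoc Cod_star Dom_star Ide_Comp star_Arr Comp_star)

text \<open>Left translation by \<open>star G g\<close> is the inverse map.\<close>

lemma bij_betw_Comp: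
  assumes "g \<in> Arr G"
  shows "bij_betw (\<lambda>h. g \<cdot> h) (into G (Dom G g)) (into G (Cod G g))"
  by (rule bij_betw_byWitness[where f' = "\<lambda>h. star G g \<cdot> h"])
    (use assms in \<open>auto simp: into_def star_Comp_cancel Comp_star_cancel Comp_Arr Cod_Comp
      star_Arr Dom_star Cod_star\<close>)

end

section \<open>Protorootoids\<close>

context protorootoid
begin

abbreviation "\<G> \<equiv> Gpd R"

sublocale G: groupoid \<G>
  by (rule groupoid)

section \<open>Invertibility of the action of arrows on the Boolean rings\<close>

lemma Act_closed: "\<lbrakk>g \<in> Arr \<G>; x \<in> carrier (Lam R (Dom \<G> g))\<rbrakk> \<Longrightarrow> Act R g x \<in> carrier (Lam R (Cod \<G> g))"
  using Act_hom by (auto simp: rng_hom_def)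

lemma Act_star_Act:
  assumes "g \<in> Arr \<G>" "x \<in> carrier (Lam R (Dom \<G> g))"
  shows "Act R (star \<G> g) (Act R g x) = x"
  using assms by (metis Act_Comp Act_Ide G.Dom_Obj G.Dom_star G.star_Arr G.star_Comp)

lemma Act_Act_star:
  assumes "g \<in> Arr \<G>" "x \<in> carrier (Lam R (Cod \<G> g))"
  shows "Act R g (Act R (star \<G> g) x) = x"
  using assms by (metis Act_Comp Act_Ide G.Cod_Obj G.Dom_star G.Cod_star G.star_Arr G.Comp_star)

lemma Act_image:
  assumes "g \<in> Arr \<G>"
  shows "Act R g ` carrier (Lam R (Dom \<G> g)) = carrier (Lam R (Cod \<G> g))"
proof
  show "carrier (Lam R (Cod \<G> g)) \<subseteq> Act R g ` carrier (Lam R (Dom \<G> g))"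
    using assms Act_Act_star Act_closed[OF G.star_Arr[OF assms]]
    by (metis G.Cod_star G.Dom_star image_eqI subsetI)
qed (use assms Act_closed in auto)

text \<open>Multiplicativity shows that the order is preserved, and injectivity, from
  \<open>Act_star_Act\<close>, that it is reflected.\<close>

lemma Act_sub_iff:
  assumes g: "g \<in> Arr \<G>" and x: "x \<in> carrier (Lam R (Dom \<G> g))" and y: "y \<in> carrier (Lam R (Dom \<G> g))"
  shows "sub (Lam R (Cod \<G> g)) (Act R g x) (Act R g y) \<longleftrightarrow> sub (Lam R (Dom \<G> g)) x y"
proof -
  interpret B: boolean_rng "Lam R (Dom \<G> g)"
    using g Lam_boolean G.Dom_Obj by blast
  have "Act R g x \<otimes>\<^bsub>Lam R (Cod \<G> g)\<^esub> Act R g y = Act R g (x \<otimes>\<^bsub>Lam R (Dom \<G> g)\<^esub> y)"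
    using g x y Act_hom by (simp add: rng_hom_def)
  then show ?thesis
    using g x y B.mult_closed unfolding sub_def by (metis Act_star_Act)
qed

lemma Ncoc_Ide:
  assumes a: "a \<in> Obj \<G>"
  shows "Ncoc R (Ide \<G> a) = \<zero>\<^bsub>Lam R a\<^esub>"
proof -
  interpret B: boolean_rng "Lam R a"
    using a by (rule Lam_boolean)
  have i: "Ncoc R (Ide \<G> a) \<in> carrier (Lam R a)"
    using a Ncoc_in G.Ide_Arr G.Cod_Ide by metis
  \<comment> \<open>The cocycle identity for the product of the identity arrow with itself.\<close>
  have "Ncoc R (Ide \<G> a) = Ncoc R (Ide \<G> a) \<oplus>\<^bsub>Lam R a\<^esub> Ncoc R (Ide \<G> a)"
    using a i Ncoc_Comp[of "Ide \<G> a" "Ide \<G> a"] G.Comp_Ide[of "Ide \<G> a"]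
    by (simp add: G.Ide_Arr G.Dom_Ide G.Cod_Ide Act_Ide)
  then show ?thesis
    using i by (simp add: B.add_self)
qed

lemma Ncoc_into: "g \<in> into \<G> a \<Longrightarrow> Ncoc R g \<in> carrier (Lam R a)"
  using Ncoc_in by (auto simp: into_def)

lemma weak_order_subset: "carrier (weak_order R a) \<subseteq> carrier (Lam R a)"
  by (auto simp: weak_order_def intro: Ncoc_into)

lemma zero_in_weak_order: "a \<in> Obj \<G> \<Longrightarrow> \<zero>\<^bsub>Lam R a\<^esub> \<in> carrier (weak_order R a)"
  unfolding weak_order_def into_def using Ncoc_Ide G.Ide_Arr G.Cod_Ide by force

text \<open>Faithfulness only controls arrows with value zero. The cocycle identity upgrades it to
  injectivity of \<open>N\<close> by comparing \<open>g\<close> and \<open>h\<close> through the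
  quotient \<open>star \<G> g\<close> times \<open>h\<close>.\<close>

lemma Ncoc_eqD:
  assumes "faithful R" and g: "g \<in> into \<G> a" and h: "h \<in> into \<G> a" and eq: "Ncoc R g = Ncoc R h"
  shows "g = h"
proof -
  let ?k = "star \<G> g \<cdot>\<^bsub>\<G>\<^esub> h"
  have gh: "g \<in> Arr \<G>" "h \<in> Arr \<G>" "Cod \<G> g = a" "Cod \<G> h = a"
    using g h by (auto simp: into_def)
  \<comment> \<open>In the cocycle identity the second factor enters only through its value under
    \<open>N\<close>, so \<open>h\<close> may be replaced by \<open>g\<close>.\<close>
  have "Ncoc R ?k = Ncoc R (star \<G> g \<cdot>\<^bsub>\<G>\<^esub> g)"
    using gh eq by (simp add: Ncoc_Comp G.star_Arr G.Dom_star)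
  also have "\<dots> = \<zero>\<^bsub>Lam R (Dom \<G> g)\<^esub>"
    using gh by (simp add: G.star_Comp Ncoc_Ide G.Dom_Obj)
  finally have "?k = Ide \<G> (Dom \<G> g)"
    using assms(1) gh
    by (simp add: faithful_def into_def G.Comp_Arr G.Cod_Comp G.star_Arr G.Dom_star G.Cod_star G.Dom_Obj)
  then show ?thesis
    using gh by (metis G.Comp_star_cancel G.Comp_Ide)
qed

end

section \<open>Complete protorootoids\<close>

locale faithful_complete_abridged_protorootoid = protorootoid +
  assumes faithful: "faithful R" and complete: "complete R" and abridged: "abridged R"
begin

section \<open>The maximum arrows and the identity elements they give\<close>

abbreviation "\<omega> \<equiv> omega R"

lemma complete_lattice_weak_order: "a \<in> Obj \<G> \<Longrightarrow> complete_lattice (weak_order R a)"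
  using complete by (simp add: complete_def)

text \<open>The preorder on arrows is pulled back along \<open>N\<close>, so any arrow over the top
  of the weak order is a maximum. Two maxima have equal values by antisymmetry, and injectivity of
  \<open>N\<close> makes them equal.\<close>

lemma ex1_maximum:
  assumes a: "a \<in> Obj \<G>"
  shows "\<exists>!w. is_maximum (weak_right_order R a) w"
proof -
  interpret B: boolean_rng "Lam R a"
    using a by (rule Lam_boolean)
  interpret L: complete_lattice "weak_order R a"
    using a by (rule complete_lattice_weak_order)
  obtain w where w: "w \<in> into \<G> a" "\<top>\<^bsub>weak_order R a\<^esub> = Ncoc R w"
    using L.top_closed by (auto simp: weak_order_def)
  have le: "sub (Lam R a) (Ncoc R g) (Ncoc R w)" if "g \<in> into \<G> a" for g
    using L.top_higher[of "Ncoc R g"] that w by (simp add: weak_order_def)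
  have "is_maximum (weak_right_order R a) w"
    using w le by (simp add: is_maximum_def greatest_def weak_right_order_def)
  moreover have "v = w" if "is_maximum (weak_right_order R a) v" for v
  proof (rule Ncoc_eqD[OF faithful])
    show v: "v \<in> into \<G> a"
      using that by (simp add: is_maximum_def greatest_def weak_right_order_def)
    show "Ncoc R v = Ncoc R w"
      using that v w le Ncoc_into
      by (auto simp: is_maximum_def greatest_def weak_right_order_def intro: B.sub_antisym)
  qed (use w in auto)
  ultimately show ?thesis by blast
qed

lemma omega_maximum: "a \<in> Obj \<G> \<Longrightarrow> is_maximum (weak_right_order R a) (\<omega> a)"
  unfolding omega_def by (rule theI', rule ex1_maximum)

lemma omega_into: "a \<in> Obj \<G> \<Longrightarrow> \<omega> a \<in> into \<G> a"
  using omega_maximum by (simp add: is_maximum_def greatest_def weak_right_order_def)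

lemma omega_Arr: "a \<in> Obj \<G> \<Longrightarrow> \<omega> a \<in> Arr \<G>"
  and Cod_omega: "a \<in> Obj \<G> \<Longrightarrow> Cod \<G> (\<omega> a) = a"
  using omega_into by (simp_all add: into_def)

lemma sub_omega:
  assumes "a \<in> Obj \<G>" "g \<in> into \<G> a"
  shows "sub (Lam R a) (Ncoc R g) (Ncoc R (\<omega> a))"
  using assms omega_maximum by (simp add: is_maximum_def greatest_def weak_right_order_def)

lemma is_lub_omega:
  assumes "a \<in> Obj \<G>"
  shows "is_lub (weak_right_order R a) (\<omega> a) (into \<G> a)"
  using assms omega_into sub_omega by (auto simp: least_def Upper_def weak_right_order_def)

lemma is_lub_Ncoc_omega:
  assumes "a \<in> Obj \<G>"
  shows "is_lub (weak_order R a) (Ncoc R (\<omega> a)) (carrier (weak_order R a))"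
  using assms omega_into sub_omega by (auto simp: least_def Upper_def weak_order_def)

text \<open>Abridgedness enters here: the weak order generates the ring, and all its elements lie
  below \<open>N\<close> of the maximum arrow.\<close>

lemma is_identity_omega:
  assumes a: "a \<in> Obj \<G>"
  shows "is_identity (Lam R a) (Ncoc R (\<omega> a))"
proof -
  interpret B: boolean_rng "Lam R a"
    using a by (rule Lam_boolean)
  show ?thesis
  proof (rule B.is_identityI_span)
    show "rng_span (Lam R a) (carrier (weak_order R a)) = carrier (Lam R a)"
      using a abridged by (simp add: abridged_def)
  qed (use a weak_order_subset omega_into sub_omega Ncoc_into in \<open>auto simp: weak_order_def\<close>)
qed

lemma identity_omega: "a \<in> Obj \<G> \<Longrightarrow> identity (Lam R a) = Ncoc R (\<omega> a)"
  by (rule identity_eqI, rule is_identity_omega)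

text \<open>Both sides are identity elements of the same ring: the left one is transported along a
  surjective homomorphism.\<close>

lemma Act_omega:
  assumes g: "g \<in> Arr \<G>"
  shows "Act R g (Ncoc R (\<omega> (Dom \<G> g))) = Ncoc R (\<omega> (Cod \<G> g))"
proof (rule is_identity_unique)
  show "is_identity (Lam R (Cod \<G> g)) (Act R g (Ncoc R (\<omega> (Dom \<G> g))))"
    using g by (intro is_identity_image[OF Act_hom Act_image] is_identity_omega G.Dom_Obj)
  show "is_identity (Lam R (Cod \<G> g)) (Ncoc R (\<omega> (Cod \<G> g)))"
    using g by (intro is_identity_omega G.Cod_Obj)
qed

lemma unitary: "unitary R"
  unfolding unitary_def boolean_alg_def
  using Lam_boolean is_identity_omega Act_omega G.Dom_Obj G.Cod_Obj by (auto simp: identity_omega)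

section \<open>Multiplication by maximum arrows as complementation\<close>

lemma Ncoc_Comp_omega:
  assumes g: "g \<in> Arr \<G>"
  shows "Ncoc R (g \<cdot>\<^bsub>\<G>\<^esub> \<omega> (Dom \<G> g)) = compl (Lam R (Cod \<G> g)) (Ncoc R g)"
proof -
  interpret B: boolean_rng "Lam R (Cod \<G> g)"
    using g Lam_boolean G.Cod_Obj by blast
  \<comment> \<open>In the cocycle identity the second summand is the transported identity element,
    which \<open>Act_omega\<close> evaluates.\<close>
  have "Ncoc R (g \<cdot>\<^bsub>\<G>\<^esub> \<omega> (Dom \<G> g)) = Ncoc R g \<oplus>\<^bsub>Lam R (Cod \<G> g)\<^esub> Ncoc R (\<omega> (Cod \<G> g))"
    using g by (simp add: Ncoc_Comp omega_Arr Cod_omega Act_omega G.Dom_Obj)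
  also have "\<dots> = Ncoc R (\<omega> (Cod \<G> g)) \<oplus>\<^bsub>Lam R (Cod \<G> g)\<^esub> Ncoc R g"
    using g Ncoc_in Ncoc_into omega_into G.Cod_Obj by (simp add: B.a_comm)
  finally show ?thesis
    using g by (simp add: compl_def identity_omega G.Cod_Obj)
qed

lemma star_omega:
  assumes a: "a \<in> Obj \<G>"
  shows "star \<G> (\<omega> a) = \<omega> (Dom \<G> (\<omega> a))"
proof (rule G.star_eqI)
  let ?w = "\<omega> a" and ?v = "\<omega> (Dom \<G> (\<omega> a))"
  interpret B: boolean_rng "Lam R a"
    using a by (rule Lam_boolean)
  show w: "?w \<in> Arr \<G>"
    using a by (rule omega_Arr)
  have d: "Dom \<G> ?w \<in> Obj \<G>"
    using w by (rule G.Dom_Obj)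
  show v: "?v \<in> Arr \<G>" "Cod \<G> ?v = Dom \<G> ?w"
    using d omega_Arr Cod_omega by auto
  \<comment> \<open>Taking \<open>g\<close> to be \<open>\<omega> a\<close> itself, the value is the
    complement of the identity element, hence zero; faithfulness then forces an identity
    arrow.\<close>
  have "Ncoc R (?w \<cdot>\<^bsub>\<G>\<^esub> ?v) = \<zero>\<^bsub>Lam R a\<^esub>"
    using a w Ncoc_Comp_omega[OF w] Ncoc_into[OF omega_into[OF a]]
    by (simp add: Cod_omega compl_def identity_omega B.add_self)
  then show "?w \<cdot>\<^bsub>\<G>\<^esub> ?v = Ide \<G> (Cod \<G> ?w)"
    using a w v faithful
    by (simp add: faithful_def into_def G.Comp_Arr G.Cod_Comp Cod_omega)
qed

lemma Ncoc_omega_Comp: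
  assumes a: "a \<in> Obj \<G>" and h: "h \<in> into \<G> (Dom \<G> (\<omega> a))"
  shows "Ncoc R (\<omega> a \<cdot>\<^bsub>\<G>\<^esub> h) = compl (Lam R a) (Act R (\<omega> a) (Ncoc R h))"
  using a h Ncoc_Comp[of "\<omega> a" h]
  by (simp add: into_def omega_Arr Cod_omega compl_def identity_omega)

text \<open>On values under \<open>N\<close>, left multiplication by \<open>\<omega> a\<close> is
  the action of \<open>\<omega> a\<close>, which preserves and reflects the order, followed by
  complementation, which reverses it.\<close>

lemma order_anti_iso_omega_Comp:
  assumes a: "a \<in> Obj \<G>"
  shows "order_anti_iso (weak_right_order R (Dom \<G> (\<omega> a))) (weak_right_order R a)
    (\<lambda>h. \<omega> a \<cdot>\<^bsub>\<G>\<^esub> h)"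
proof -
  interpret B: boolean_rng "Lam R a"
    using a by (rule Lam_boolean)
  note w = omega_Arr[OF a]
  have "sub (Lam R a) (Ncoc R (\<omega> a \<cdot>\<^bsub>\<G>\<^esub> y)) (Ncoc R (\<omega> a \<cdot>\<^bsub>\<G>\<^esub> x)) \<longleftrightarrow>
      sub (Lam R (Dom \<G> (\<omega> a))) (Ncoc R x) (Ncoc R y)"
    if "x \<in> into \<G> (Dom \<G> (\<omega> a))" "y \<in> into \<G> (Dom \<G> (\<omega> a))" for x y
    using a that Act_sub_iff[OF w Ncoc_into Ncoc_into] Act_closed[OF w Ncoc_into]
    by (simp add: Ncoc_omega_Comp B.compl_sub_compl_iff[OF is_identity_omega[OF a]] Cod_omega)
  then show ?thesis
    using G.bij_betw_Comp[OF w] a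
    by (simp add: order_anti_iso_def weak_right_order_def Cod_omega)
qed

section \<open>Closure under complements, the ortholattice and the rootoid axioms\<close>

lemma compl_in_weak_order:
  assumes A: "A \<in> carrier (weak_order R a)"
  shows "compl (Lam R a) A \<in> carrier (weak_order R a)"
proof -
  obtain g where g: "g \<in> Arr \<G>" "Cod \<G> g = a" "A = Ncoc R g"
    using A by (auto simp: weak_order_def into_def)
  then have "g \<cdot>\<^bsub>\<G>\<^esub> \<omega> (Dom \<G> g) \<in> into \<G> a"
    by (simp add: into_def G.Comp_Arr G.Cod_Comp omega_Arr Cod_omega G.Dom_Obj)
  then show ?thesis
    using g Ncoc_Comp_omega[OF g(1)] by (auto simp: weak_order_def image_iff intro!: bexI)
qed

lemma complemented: "complemented R"
  by (simp add: complemented_def unitary compl_in_weak_order)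

text \<open>Meets and joins of the weak order need not be those of the Boolean ring. The complement
  laws are therefore derived from lower bounds, with joins reduced to meets by duality.\<close>

lemma complete_ortholattice_weak_order:
  assumes a: "a \<in> Obj \<G>"
  shows "complete_ortholattice (weak_order R a) (compl (Lam R a))"
proof -
  let ?L = "weak_order R a" and ?c = "compl (Lam R a)"
  interpret B: boolean_rng "Lam R a"
    using a by (rule Lam_boolean)
  interpret L: complete_lattice ?L
    using a by (rule complete_lattice_weak_order)
  note e = is_identity_omega[OF a]
  have le: "x \<sqsubseteq>\<^bsub>?L\<^esub> y \<longleftrightarrow> sub (Lam R a) x y" for x y
    by (simp add: weak_order_def)
  have carr: "x \<in> carrier (Lam R a)" if "x \<in> carrier ?L" for x
    using that weak_order_subset by blast
  note c = compl_in_weak_order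
  have anti: "?c y \<sqsubseteq>\<^bsub>?L\<^esub> ?c x" if "x \<in> carrier ?L" "y \<in> carrier ?L" "x \<sqsubseteq>\<^bsub>?L\<^esub> y" for x y
    using that carr by (simp add: le B.compl_sub_compl_iff[OF e])
  have cc: "?c (?c x) = x" if "x \<in> carrier ?L" for x
    using that carr B.compl_compl[OF e] by blast
  \<comment> \<open>Zero is the value of the identity arrow, so it lies in the weak order.\<close>
  have bot: "\<zero>\<^bsub>Lam R a\<^esub> = \<bottom>\<^bsub>?L\<^esub>"
    using a carr zero_in_weak_order[OF a] B.zero_sub
    by (intro L.le_antisym L.bottom_lower) (simp_all add: le)
  have lower: "z = \<bottom>\<^bsub>?L\<^esub>" if "x \<in> carrier ?L" "z \<in> carrier ?L" "z \<sqsubseteq>\<^bsub>?L\<^esub> x" "z \<sqsubseteq>\<^bsub>?L\<^esub> ?c x" for x z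
    using that B.sub_self_compl[OF e carr carr] by (simp add: le bot)
  have meet: "x \<sqinter>\<^bsub>?L\<^esub> ?c x = \<bottom>\<^bsub>?L\<^esub>" if "x \<in> carrier ?L" for x
    using that c by (intro lower[of x]) (auto intro: L.meet_left L.meet_right)
  have join: "x \<squnion>\<^bsub>?L\<^esub> ?c x = \<top>\<^bsub>?L\<^esub>" if x: "x \<in> carrier ?L" for x
  proof -
    let ?j = "x \<squnion>\<^bsub>?L\<^esub> ?c x"
    have j: "?j \<in> carrier ?L" "x \<sqsubseteq>\<^bsub>?L\<^esub> ?j" "?c x \<sqsubseteq>\<^bsub>?L\<^esub> ?j"
      using x c by (auto intro: L.join_left L.join_right)
    \<comment> \<open>From \<open>x\<close> and \<open>?c x\<close> both lying below
      \<open>?j\<close>, the complement of \<open>?j\<close> lies below \<open>?c x\<close> and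
      below \<open>?c (?c x)\<close>, which is \<open>x\<close>.\<close>
    have "?c ?j = \<bottom>\<^bsub>?L\<^esub>"
      using x j c anti[of x ?j] anti[of "?c x" ?j] cc by (intro lower[of x]) auto
    moreover have "?c \<top>\<^bsub>?L\<^esub> = \<bottom>\<^bsub>?L\<^esub>"
    proof (rule L.le_antisym)
      show "?c \<top>\<^bsub>?L\<^esub> \<sqsubseteq>\<^bsub>?L\<^esub> \<bottom>\<^bsub>?L\<^esub>"
        \<comment> \<open>The complement of bottom lies below top; complementing this once more puts
          the complement of top below bottom.\<close>
        using anti[of "?c \<bottom>\<^bsub>?L\<^esub>" "\<top>\<^bsub>?L\<^esub>"] c cc by auto
    qed (use c in auto)
    ultimately show ?thesis
      using cc[OF j(1)] cc[OF L.top_closed] by simp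
  qed
  show ?thesis
    unfolding complete_ortholattice_def
    using L.complete_lattice_axioms complete_lattice_weak_order[OF a] c anti cc meet join by auto
qed

text \<open>Orthogonality to \<open>B\<close> means lying below the complement of \<open>B\<close>, which belongs to the weak order.\<close>

lemma join_orthogonal:
  assumes a: "a \<in> Obj \<G>" and X: "X \<subseteq> carrier (weak_order R a)"
    and B: "B \<in> carrier (weak_order R a)" and orth: "\<forall>A\<in>X. A \<otimes>\<^bsub>Lam R a\<^esub> B = \<zero>\<^bsub>Lam R a\<^esub>"
    and J: "least (weak_order R a) J (Upper (weak_order R a) X)"
  shows "J \<otimes>\<^bsub>Lam R a\<^esub> B = \<zero>\<^bsub>Lam R a\<^esub>"
proof -
  interpret B: boolean_rng "Lam R a"
    using a by (rule Lam_boolean)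
  note sub_compl_iff = B.sub_compl_iff[OF is_identity_omega[OF a]]
  have carr: "x \<in> carrier (Lam R a)" if "x \<in> carrier (weak_order R a)" for x
    using that weak_order_subset by blast
  have "compl (Lam R a) B \<in> Upper (weak_order R a) X"
    using X B orth carr sub_compl_iff
    by (intro Upper_memI compl_in_weak_order) (auto simp: weak_order_def subset_iff)
  with J have "sub (Lam R a) J (compl (Lam R a) B)"
    by (simp add: least_def weak_order_def)
  then show ?thesis
    using sub_compl_iff carr B J by (metis least_closed)
qed

lemma rootoid: "rootoid R"
proof unfold_locales
  fix a assume a: "a \<in> Obj \<G>"
  interpret L: complete_lattice "weak_order R a"
    using a by (rule complete_lattice_weak_order)
  show "complete_meet_semilattice (weak_order R a)"
    using L.inf_exists L.partial_order_axioms by (simp add: complete_meet_semilattice_def)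
qed (use Ncoc_eqD[OF faithful] join_orthogonal in auto)

end

theorem proposition7p1:
  fixes R :: "('o, 'm, 'b, 'c) protorootoid_data_scheme" and a :: 'o
  assumes "protorootoid R" and "faithful R" and "complete R" and "abridged R"
    and "a \<in> Obj (Gpd R)"
  shows
    "((\<exists>!w. is_maximum (weak_right_order R a) w) \<and>
       is_maximum (weak_right_order R a) (omega R a) \<and>
       is_lub (weak_right_order R a) (omega R a) (into (Gpd R) a) \<and>
       is_lub (weak_order R a) (Ncoc R (omega R a)) (carrier (weak_order R a))) \<and>
     is_identity (Lam R a) (Ncoc R (omega R a)) \<and>
     unitary R \<and>
     (Dom (Gpd R) (omega R a) \<in> Obj (Gpd R) \<and>
       omega R a \<in> hom_set (Gpd R) a (Dom (Gpd R) (omega R a)) \<and>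
       star (Gpd R) (omega R a) = omega R (Dom (Gpd R) (omega R a))) \<and>
     order_anti_iso (weak_right_order R (Dom (Gpd R) (omega R a))) (weak_right_order R a)
       (\<lambda>h. omega R a \<cdot>\<^bsub>Gpd R\<^esub> h) \<and>
     (\<forall>b\<in>Obj (Gpd R). \<forall>g\<in>hom_set (Gpd R) b a.
       Ncoc R (g \<cdot>\<^bsub>Gpd R\<^esub> omega R a) = compl (Lam R b) (Ncoc R g) \<and>
       compl (Lam R b) (Ncoc R g) = Ncoc R (omega R b) \<oplus>\<^bsub>Lam R b\<^esub> Ncoc R g) \<and>
     complete_ortholattice (weak_order R a) (compl (Lam R a)) \<and>
     (complemented R \<and> complete R \<and> rootoid R)"
proof -
  interpret faithful_complete_abridged_protorootoid R
    using assms
    by (simp add: faithful_complete_abridged_protorootoid_def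
        faithful_complete_abridged_protorootoid_axioms_def)
  note a = \<open>a \<in> Obj (Gpd R)\<close>
  have "omega R a \<in> hom_set (Gpd R) a (Dom (Gpd R) (omega R a))"
    using a by (simp add: hom_set_def omega_Arr Cod_omega)
  moreover have "\<forall>b\<in>Obj (Gpd R). \<forall>g\<in>hom_set (Gpd R) b a.
      Ncoc R (g \<cdot>\<^bsub>Gpd R\<^esub> omega R a) = compl (Lam R b) (Ncoc R g) \<and>
      compl (Lam R b) (Ncoc R g) = Ncoc R (omega R b) \<oplus>\<^bsub>Lam R b\<^esub> Ncoc R g"
    \<comment> \<open>Membership in \<open>hom_set\<close> fixes the domain of \<open>g\<close> as
      \<open>a\<close>, so the maximum arrow at that domain is \<open>omega R a\<close>.\<close>
    using Ncoc_Comp_omega by (auto simp: hom_set_def compl_def identity_omega)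
  ultimately show ?thesis
    using a ex1_maximum omega_maximum is_lub_omega is_lub_Ncoc_omega is_identity_omega unitary
      G.Dom_Obj[OF omega_Arr] star_omega order_anti_iso_omega_Comp complete_ortholattice_weak_order
      complemented complete rootoid
    by (intro conjI)
qed

end
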